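(* Let $\sigma$ be a permutation of $\mathbb{N}_0$ and $n\in\mathbb{N}_0$. Then $\|F^\sigma_{2^n}\|_4^4=\#A^\sigma_n$.
   Context: $\mathbb{N}_0=\{0,1,2,\ldots\}$ and $[m]=\{0,1,\ldots,m-1\}$; $\#A$ is the cardinality of $A$. For $n\in\mathbb{N}_0$ with binary expansion $n=\sum_{i\ge0} n_i2^i$, $n_i\in\{0,1\}$, the dyadic sum is $m\oplus n=\sum_{i\ge 0}|m_i-n_i|2^i$ (bitwise XOR). On $[0,1]$, $e_n(t)=\exp(2\pi i n t)$; $r_0,r_1,\ldots$ are the Rademacher functions ($r_i(t)=\operatorname{sign}\sin(2^{i+1}\pi t)$), and $w_n=\prod_{i\ge 0} r_i^{n_i}$ is the $n$-th Walsh function. For $N\ge1$, $F^\sigma_N(s,t)=\sum_{k=0}^{N-1}e_k(s)w_{\sigma(k)}(t)$ on $[0,1]^2$, and $\|F^\sigma_N\|_4$ is its norm in $L_4([0,1]^2)$. $A^\sigma_n=\{(k,l,m)\in[2^n]^3 : k+l-m\in[2^n],\ \sigma(k)\oplus\sigma(l)\oplus\sigma(m)=\sigma(k+l-m)\}$. *)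

theory Defs
  imports "HOL-Analysis.Analysis"
begin

unbundle bit_operations_syntax

definition trig :: "nat \<Rightarrow> real \<Rightarrow> complex" where
  "trig n t = exp (2 * complex_of_real pi * \<i> * of_nat n * complex_of_real t)"

definition rademacher :: "nat \<Rightarrow> real \<Rightarrow> real" where
  "rademacher i t = sgn (sin (2 ^ (i + 1) * pi * t))"

text \<open>The infinite product of the factors \<open>r\<^sub>i\<close> to the power \<open>n\<^sub>i\<close> is written as the product over
  the binary digits \<open>n\<^sub>i = 1\<close> of \<open>n\<close>; there are only finitely many of them.\<close>

definition walsh :: "nat \<Rightarrow> real \<Rightarrow> real" where
  "walsh n t = (\<Prod>i | bit n i. rademacher i t)"

lemma finite_bits: "finite {i. bit (n :: nat) i}"
proof (rule finite_subset)
  show "{i. bit n i} \<subseteq> {..<n}"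
  proof
    fix i assume "i \<in> {i. bit n i}"
    then have "2 ^ i \<le> n"
      by (metis bit_nat_def div_less dvd_0_right mem_Collect_eq not_le)
    then show "i \<in> {..<n}"
      using less_le_trans[OF less_exp, of i n] by simp
  qed
qed simp

definition F_sigma :: "(nat \<Rightarrow> nat) \<Rightarrow> nat \<Rightarrow> real \<times> real \<Rightarrow> complex" where
  "F_sigma \<sigma> N = (\<lambda>(s, t). \<Sum>k<N. trig k s * complex_of_real (walsh (\<sigma> k) t))"

text \<open>The norm of \<open>L\<^sub>p(M)\<close> for \<open>0 < p < \<infinity>\<close>. The Bochner integral is 0 for non-integrable
  integrands, so this is meaningful only for members of \<open>L\<^sub>p(M)\<close>; see \<open>F_sigma_in_Lp\<close> below.\<close>

definition Lp_norm :: "real \<Rightarrow> 'a measure \<Rightarrow> ('a \<Rightarrow> 'b::real_normed_vector) \<Rightarrow> real" where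
  "Lp_norm p M f = (LINT x|M. norm (f x) powr p) powr (1 / p)"

abbreviation unit_square :: "(real \<times> real) measure" where
  "unit_square \<equiv> lebesgue_on ({0..1} \<times> {0..1})"

lemma F_sigma_measurable: "F_sigma \<sigma> N \<in> borel_measurable unit_square"
proof -
  have [measurable]: "trig k \<in> borel_measurable borel" for k
    unfolding trig_def by (intro borel_measurable_continuous_onI continuous_intros)
  have [measurable]: "rademacher i \<in> borel_measurable borel" for i
    unfolding rademacher_def by measurable
  have [measurable]: "walsh k \<in> borel_measurable borel" for k
    unfolding walsh_def by measurable
  have "F_sigma \<sigma> N \<in> borel_measurable (borel \<Otimes>\<^sub>M borel)"
    unfolding F_sigma_def by measurable
  then have "F_sigma \<sigma> N \<in> borel_measurable borel"
    by (simp add: borel_prod)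
  then have "F_sigma \<sigma> N \<in> borel_measurable lborel"
    by simp
  then show ?thesis
    by (intro measurable_restrict_space1 measurable_completion)
qed

lemma F_sigma_in_Lp:
  assumes "p > 0"
  shows "integrable unit_square (\<lambda>x. norm (F_sigma \<sigma> N x) powr p)"
proof -
  have walsh: "\<bar>walsh n t\<bar> \<le> 1" for n t
    unfolding walsh_def abs_prod
    by (rule prod_le_1) (simp add: rademacher_def sgn_if)
  have trig: "norm (trig n t) = 1" for n t
    by (simp add: trig_def norm_exp_eq_Re)
  have bound: "norm (F_sigma \<sigma> N x) \<le> real N" for x
  proof -
    have "norm (F_sigma \<sigma> N x) \<le> (\<Sum>k<N. 1)"
      unfolding F_sigma_def split_beta
      by (intro sum_norm_le) (simp add: norm_mult trig walsh)
    then show ?thesis by simp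
  qed
  have sq: "{0..1::real} \<times> {0..1::real} \<in> lmeasurable"
    by (metis cbox_Pair_eq cbox_interval lmeasurable_cbox)
  interpret finite_measure unit_square
    using sq by (rule finite_measure_lebesgue_on)
  have "(\<lambda>x. norm (F_sigma \<sigma> N x) powr p) \<in> borel_measurable unit_square"
    using F_sigma_measurable by measurable
  then show ?thesis
    using bound assms
    by (intro integrable_const_bound[where B = "real N powr p"] AE_I2) (simp_all add: powr_mono2)
qed

text \<open>The requirement \<open>k + l - m \<in> [2\<^sup>n]\<close> refers to integer subtraction; on \<open>nat\<close> it needs
  \<open>m \<le> k + l\<close>. \<open>XOR\<close> is the dyadic sum.\<close>

definition A_sigma :: "(nat \<Rightarrow> nat) \<Rightarrow> nat \<Rightarrow> (nat \<times> nat \<times> nat) set" where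
  "A_sigma \<sigma> n = {(k, l, m). k < 2 ^ n \<and> l < 2 ^ n \<and> m < 2 ^ n \<and>
     m \<le> k + l \<and> k + l - m < 2 ^ n \<and>
     \<sigma> k XOR \<sigma> l XOR \<sigma> m = \<sigma> (k + l - m)}"

end

theory Submission
  imports Defs
begin

text \<open>
  The absolute value of \<open>F\<close> is raised to an even power, so \<open>\<bar>F\<bar>\<^sup>4 = F F cnj(F) cnj(F)\<close> expands
  into a finite sum over quadruples \<open>(k, l, m, p)\<close> of indices below \<open>2\<^sup>n\<close>. Every summand is a
  product of a function of \<open>s\<close> and a function of \<open>t\<close>, and by Fubini it integrates to the product
  of two one-dimensional integrals. Products and conjugates of characters are characters: the
  function of \<open>s\<close> is the exponential of frequency \<open>k + l - m - p\<close>, and the function of \<open>t\<close> is,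
  off the null set of dyadic points, the Walsh function with index
  \<open>\<sigma>(k) \<oplus> \<sigma>(l) \<oplus> \<sigma>(m) \<oplus> \<sigma>(p)\<close>. A character integrates to 1 if it is trivial and to 0 otherwise.
  Hence the integral counts the quadruples with \<open>p = k + l - m\<close> and
  \<open>\<sigma>(p) = \<sigma>(k) \<oplus> \<sigma>(l) \<oplus> \<sigma>(m)\<close>, and these correspond to the triples in \<open>A\<close>.

  The vanishing of the integral of a nontrivial character has the same reason in both systems: the
  function is 1-periodic and some translation changes its sign
  (lemma \<open>integral_antiperiodic_eq_0\<close>).
\<close>

section \<open>Integrals of products over the unit square\<close>

lemma (in pair_sigma_finite) has_bochner_integral_mult_pair:
  fixes u :: "'a \<Rightarrow> complex" and v :: "'b \<Rightarrow> complex"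
  assumes u: "integrable M1 u" and v: "integrable M2 v"
  shows "has_bochner_integral (M1 \<Otimes>\<^sub>M M2) (\<lambda>(x, y). u x * v y)
    (integral\<^sup>L M1 u * integral\<^sup>L M2 v)"
proof -
  have [measurable]: "u \<in> borel_measurable M1" "v \<in> borel_measurable M2"
    using u v by auto
  have int: "integrable (M1 \<Otimes>\<^sub>M M2) (\<lambda>(x, y). u x * v y)"
    by (rule Fubini_integrable) (use u v in \<open>auto simp: norm_mult\<close>)
  then have "integral\<^sup>L (M1 \<Otimes>\<^sub>M M2) (\<lambda>(x, y). u x * v y) = integral\<^sup>L M1 u * integral\<^sup>L M2 v"
    using integral_fst'[OF int] by simp
  with int show ?thesis
    by (simp add: has_bochner_integral_iff)
qed

text \<open>The completed Lebesgue measure on the square is not a product measure, but for Borel functions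
  it gives the same integrals as \<open>lborel\<close>, which is one.\<close>

lemma has_bochner_integral_unit_square_mult:
  fixes u v :: "real \<Rightarrow> complex"
  assumes u: "set_integrable lborel {0..1} u" and v: "set_integrable lborel {0..1} v"
  shows "has_bochner_integral unit_square (\<lambda>(s, t). u s * v t)
    ((LINT s:{0..1}|lborel. u s) * (LINT t:{0..1}|lborel. v t))"
proof -
  let ?S = "{0..1::real} \<times> {0..1::real}"
  let ?g = "\<lambda>(s, t). (indicator {0..1} s *\<^sub>R u s) * (indicator {0..1} t *\<^sub>R v t)"
  have g: "?g = (\<lambda>x. indicator ?S x *\<^sub>R (case x of (s, t) \<Rightarrow> u s * v t))"
    by (auto simp: fun_eq_iff indicator_def)
  have S: "?S \<in> sets lebesgue"
    by (metis cbox_Pair_eq cbox_interval lmeasurable_cbox fmeasurableD)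
  have "has_bochner_integral (lborel \<Otimes>\<^sub>M lborel) ?g
      ((LINT s:{0..1}|lborel. u s) * (LINT t:{0..1}|lborel. v t))"
    using u v unfolding set_integrable_def set_lebesgue_integral_def
    by (rule lborel_pair.has_bochner_integral_mult_pair)
  then have "has_bochner_integral lborel ?g
      ((LINT s:{0..1}|lborel. u s) * (LINT t:{0..1}|lborel. v t))"
    by (simp add: lborel_prod)
  moreover from this have "?g \<in> borel_measurable lborel"
    by (auto simp: has_bochner_integral_iff)
  ultimately have "has_bochner_integral lebesgue ?g
      ((LINT s:{0..1}|lborel. u s) * (LINT t:{0..1}|lborel. v t))"
    by (simp add: has_bochner_integral_iff integrable_completion integral_completion)
  then show ?thesis
    unfolding g using S
    by (simp add: has_bochner_integral_iff integrable_restrict_space integral_restrict_space)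
qed

section \<open>Integrals of sign-reversing periodic functions\<close>

text \<open>The integral over a period does not change under translation, but translation by \<open>h\<close> reverses
  its sign.\<close>

lemma integral_antiperiodic_eq_0:
  fixes f :: "real \<Rightarrow> 'a::euclidean_space"
  assumes int: "f integrable_on {0..1}" and h: "0 \<le> h" "h \<le> 1"
    and periodic: "\<And>t. f (t + 1) = f t" and antiperiodic: "\<And>t. f (t + h) = - f t"
  shows "integral {0..1} f = 0"
proof -
  have shift1: "f \<circ> (+) 1 = f" and shifth: "f \<circ> (+) h = (\<lambda>t. - f t)"
    using periodic antiperiodic by (auto simp: fun_eq_iff add.commute)
  have h1: "f integrable_on {h..1}" and h0: "f integrable_on {0..h}"
    using int h by (auto intro: integrable_subinterval_real)
  have eq: "integral {0..h} f = integral {1..1+h} f"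
    using integral_shift_Icc_real[of 0 h f 1] by (simp add: shift1 add.commute)
  have "f integrable_on {1..1+h}"
    using integrable_on_shift_Icc_real[of f 1 0 h] h0 by (simp add: shift1 add.commute)
  with h1 have "f integrable_on {h..1+h}"
    by (rule Henstock_Kurzweil_Integration.integrable_combine[rotated 2]) (use h in auto)
  then have "integral {h..1+h} f = integral {h..1} f + integral {1..1+h} f"
    using h by (intro Henstock_Kurzweil_Integration.integral_combine[symmetric]) auto
  also have "\<dots> = integral {0..1} f"
    using h int by (simp add: eq[symmetric] add.commute Henstock_Kurzweil_Integration.integral_combine)
  finally have "integral {0..1} f = integral {0..1} (f \<circ> (+) h)"
    using integral_shift_Icc_real[of 0 1 f h] by (simp add: add.commute)
  also have "\<dots> = - integral {0..1} f"
    by (simp add: shifth)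
  finally show ?thesis
    by (simp add: eq_neg_iff_add_eq_0 flip: scaleR_2)
qed

lemma set_integrable_unit_interval_bounded:
  fixes f :: "real \<Rightarrow> complex"
  assumes "f \<in> borel_measurable borel" and "\<And>t. norm (f t) \<le> B"
  shows "set_integrable lborel {0..1} f"
proof (rule set_integrable_bound)
  show "set_integrable lborel {0..1::real} (\<lambda>_. B)"
    by (rule borel_integrable_atLeastAtMost') (rule continuous_on_const)
qed (use assms order_trans[OF assms(2) abs_ge_self] in \<open>auto simp: set_borel_measurable_def\<close>)

lemma LINT_antiperiodic_eq_0:
  fixes f :: "real \<Rightarrow> complex"
  assumes "set_integrable lborel {0..1} f" and "0 \<le> h" "h \<le> 1"
    and "\<And>t. f (t + 1) = f t" and "\<And>t. f (t + h) = - f t"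
  shows "(LINT t:{0..1}|lborel. f t) = 0"
  using set_borel_integral_eq_integral[OF assms(1)] integral_antiperiodic_eq_0[of f h] assms(2-)
  by simp

section \<open>Trigonometric characters\<close>

lemma norm_trig: "norm (trig k s) = 1"
  by (simp add: trig_def norm_exp_eq_Re)

lemma trig_prod_eq_exp:
  "trig k s * trig l s * cnj (trig m s) * cnj (trig p s) =
     exp (2 * of_real pi * \<i> * of_int (int k + int l - int m - int p) * of_real s)"
  by (simp add: trig_def exp_cnj mult_exp_exp algebra_simps)

text \<open>Translation by half of the shortest period, \<open>1 / (2\<bar>j\<bar>)\<close>, reverses the sign.\<close>

lemma LINT_exp_eq_of_bool:
  "(LINT s:{0..1}|lborel. exp (2 * of_real pi * \<i> * of_int j * of_real s)) =
     (of_bool (j = 0) :: complex)"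
proof (cases "j = 0")
  case True
  then show ?thesis
    by (simp add: set_lebesgue_integral_def)
next
  case False
  let ?f = "\<lambda>s::real. exp (2 * of_real pi * \<i> * of_int j * of_real s)"
  define h :: real where "h = 1 / (2 * \<bar>of_int j\<bar>)"
  have "1 \<le> \<bar>real_of_int j\<bar>"
    using False by linarith
  then have h: "0 \<le> h" "h \<le> 1"
    by (auto simp: h_def field_simps)
  have shift: "?f (s + r) = ?f s * exp (2 * of_real pi * \<i> * of_int j * of_real r)" for s r
    by (simp add: ring_distribs exp_add)
  have "exp (2 * of_real pi * \<i> * of_int j) = 1"
    using exp_integer_2pi[of "of_int j"] by (simp add: mult_ac)
  then have "?f (s + 1) = ?f s" for s
    using shift[of s 1] by simp
  moreover have "exp (2 * of_real pi * \<i> * of_int j * of_real h) = -1"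
  proof (cases "j > 0")
    case True
    then have *: "2 * of_real pi * \<i> * of_int j * of_real h = of_real pi * \<i>"
      by (simp add: h_def)
    show ?thesis unfolding * by (rule exp_pi_i)
  next
    case neg: False
    with False have *: "2 * of_real pi * \<i> * of_int j * of_real h = - (of_real pi * \<i>)"
      by (simp add: h_def field_simps)
    show ?thesis unfolding * exp_minus by simp
  qed
  then have "?f (s + h) = - ?f s" for s
    using shift[of s h] by simp
  moreover have "?f \<in> borel_measurable borel"
    by (intro borel_measurable_continuous_onI continuous_intros)
  then have "set_integrable lborel {0..1} ?f"
    by (rule set_integrable_unit_interval_bounded[where B = 1]) (simp add: norm_exp_eq_Re)
  ultimately have "(LINT s:{0..1}|lborel. ?f s) = 0"
    using h by (intro LINT_antiperiodic_eq_0[where h = h])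
  with False show ?thesis by simp
qed

section \<open>Walsh characters\<close>

lemma rademacher_measurable [measurable]: "rademacher i \<in> borel_measurable borel"
  unfolding rademacher_def by measurable

lemma walsh_measurable [measurable]: "walsh k \<in> borel_measurable borel"
  unfolding walsh_def by measurable

lemma abs_walsh_le_1: "\<bar>walsh k t\<bar> \<le> 1"
  unfolding walsh_def abs_prod by (rule prod_le_1) (simp add: rademacher_def sgn_if)

text \<open>The zeros of the Rademacher functions are dyadic rationals, so there are countably many.\<close>

lemma AE_rademacher_nonzero: "AE t in lborel. \<forall>i. rademacher i t \<noteq> 0"
proof (subst AE_all_countable, intro allI)
  fix i
  have "{t. rademacher i t = 0} \<subseteq> range (\<lambda>k::int. of_int k / 2 ^ (i + 1))"
  proof
    fix t assume "t \<in> {t. rademacher i t = 0}"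
    then have "sin (2 ^ (i + 1) * t * pi) = 0"
      by (simp add: rademacher_def sgn_zero_iff mult_ac)
    then obtain k :: int where "2 ^ (i + 1) * t = of_int k"
      unfolding sin_times_pi_eq_0 by (rule Ints_cases)
    then have "t = of_int k / 2 ^ (i + 1)"
      by (simp add: field_simps)
    then show "t \<in> range (\<lambda>k::int. of_int k / 2 ^ (i + 1))"
      by blast
  qed
  then have "countable {t. rademacher i t = 0}"
    by (rule countable_subset) simp
  then show "AE t in lborel. rademacher i t \<noteq> 0"
    using AE_not_in[OF countable_imp_null_set_lborel] by fastforce
qed

text \<open>The digits that \<open>a\<close> and \<open>b\<close> share contribute squares of signs, which are 1; the digits that
  remain are those of \<open>a XOR b\<close>.\<close>

lemma walsh_mult_walsh:
  assumes "\<forall>i. rademacher i t \<noteq> 0"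
  shows "walsh a t * walsh b t = walsh (a XOR b) t"
proof -
  let ?A = "{i. bit a i}" and ?B = "{i. bit b i}"
  have sq: "rademacher i t * rademacher i t = 1" for i
    using assms[rule_format, of i] by (auto simp: rademacher_def sgn_if split: if_splits)
  have split: "prod f X = prod f (X \<inter> Y) * prod f (X - Y)"
    if "finite X" for f :: "nat \<Rightarrow> real" and X Y
    using that by (rule prod.Int_Diff)
  have xor: "{i. bit (a XOR b) i} = (?A - ?B) \<union> (?B - ?A)"
    by (auto simp: bit_xor_iff)
  have "walsh a t * walsh b t =
      (\<Prod>i\<in>?A \<inter> ?B. rademacher i t * rademacher i t) *
      ((\<Prod>i\<in>?A - ?B. rademacher i t) * (\<Prod>i\<in>?B - ?A. rademacher i t))"
    unfolding walsh_def prod.distrib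
    using split[of ?A "\<lambda>i. rademacher i t" ?B] split[of ?B "\<lambda>i. rademacher i t" ?A]
    by (simp add: finite_bits Int_commute mult_ac)
  also have "\<dots> = walsh (a XOR b) t"
    unfolding walsh_def xor by (subst prod.union_disjoint) (auto simp: sq finite_bits)
  finally show ?thesis .
qed

lemma rademacher_add_multiple:
  assumes "2 ^ (i + 1) * r = 2 * of_int k"
  shows "rademacher i (t + r) = rademacher i t"
proof -
  have "2 ^ (i + 1) * pi * (t + r) = 2 ^ (i + 1) * pi * t + of_int k * (2 * pi)"
    using arg_cong[OF assms, of "\<lambda>x. x * pi"] by (simp add: algebra_simps)
  moreover have "sin (x + of_int k * (2 * pi)) = sin x" for x
    using sin.plus_of_int[of x k] by simp
  ultimately show ?thesis
    by (simp only: rademacher_def)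
qed

lemma rademacher_add_half_period: "rademacher i (t + 1 / 2 ^ (i + 1)) = - rademacher i t"
proof -
  have "2 ^ (i + 1) * pi * (t + 1 / 2 ^ (i + 1)) = 2 ^ (i + 1) * pi * t + pi"
    by (simp add: field_simps)
  then show ?thesis
    unfolding rademacher_def by (simp add: sgn_minus)
qed

text \<open>Translation by half the period of \<open>r\<^sub>j\<close>, with \<open>j\<close> the lowest nonzero digit of \<open>a\<close>, flips
  \<open>r\<^sub>j\<close> and is a whole period of every other factor.\<close>

lemma LINT_walsh_eq_of_bool:
  "(LINT t:{0..1}|lborel. complex_of_real (walsh a t)) = of_bool (a = 0)"
proof (cases "a = 0")
  case True
  then show ?thesis
    by (simp add: walsh_def set_lebesgue_integral_def)
next
  case False
  define j where "j = (LEAST i. bit a i)"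
  have "\<exists>i. bit a i"
    using False by (auto simp: bit_eq_iff)
  then have j: "bit a j" and least: "\<And>i. bit a i \<Longrightarrow> j \<le> i"
    by (auto simp: j_def intro: LeastI_ex Least_le)
  have split: "walsh a t = rademacher j t * (\<Prod>i\<in>{i. bit a i} - {j}. rademacher i t)" for t
    unfolding walsh_def using j by (intro prod.remove finite_bits) simp
  have "walsh a (t + 1) = walsh a t" for t
    unfolding walsh_def
    by (intro prod.cong refl rademacher_add_multiple[where k = "2 ^ i" for i]) simp
  moreover have "walsh a (t + 1 / 2 ^ (j + 1)) = - walsh a t" for t
  proof -
    have "rademacher i (t + 1 / 2 ^ (j + 1)) = rademacher i t" if "i \<in> {i. bit a i} - {j}" for i
    proof -
      have "j < i"
        using that least[of i] by auto
      then obtain d where "i = j + d + 1"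
        using less_imp_Suc_add by auto
      then have "(2::real) ^ (i + 1) * (1 / 2 ^ (j + 1)) = 2 * of_int (2 ^ d)"
        by (simp add: power_add)
      then show ?thesis
        by (rule rademacher_add_multiple)
    qed
    then show ?thesis
      unfolding split rademacher_add_half_period by simp
  qed
  moreover have "set_integrable lborel {0..1} (\<lambda>t. complex_of_real (walsh a t))"
    by (rule set_integrable_unit_interval_bounded[where B = 1]) (auto simp: abs_walsh_le_1)
  moreover have "(1::real) / 2 ^ (j + 1) \<le> 1"
    using one_le_power[of "2::real" "j + 1"] by (simp del: power_Suc)
  ultimately have "(LINT t:{0..1}|lborel. complex_of_real (walsh a t)) = 0"
    by (intro LINT_antiperiodic_eq_0[where h = "1 / 2 ^ (j + 1)"]) auto
  with False show ?thesis by simp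
qed

lemma LINT_walsh_prod_eq_of_bool:
  "(LINT t:{0..1}|lborel. complex_of_real (walsh a t * walsh b t * walsh c t * walsh d t)) =
     of_bool (a XOR b XOR c = d)"
proof -
  have "walsh a t * walsh b t * walsh c t * walsh d t = walsh (((a XOR b) XOR c) XOR d) t"
    if "\<forall>i. rademacher i t \<noteq> 0" for t
    by (simp only: walsh_mult_walsh[OF that])
  then have "AE t in lborel. walsh a t * walsh b t * walsh c t * walsh d t =
      walsh (((a XOR b) XOR c) XOR d) t"
    using AE_rademacher_nonzero by (auto elim!: eventually_mono)
  then have "(LINT t:{0..1}|lborel. complex_of_real (walsh a t * walsh b t * walsh c t * walsh d t)) =
      (LINT t:{0..1}|lborel. complex_of_real (walsh (((a XOR b) XOR c) XOR d) t))"
    unfolding set_lebesgue_integral_def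
    by (intro integral_cong_AE) (auto elim!: eventually_mono simp del: of_real_mult)
  moreover have "((a XOR b) XOR c) XOR d = 0 \<longleftrightarrow> a XOR b XOR c = d"
    by (metis xor.assoc xor.right_neutral xor_self_eq xor.left_neutral)
  ultimately show ?thesis
    by (simp only: LINT_walsh_eq_of_bool)
qed

section \<open>The fourth power of the norm as a number of solutions\<close>

lemma norm_sum_power4:
  fixes a :: "'i \<Rightarrow> complex"
  shows "complex_of_real (norm (\<Sum>k\<in>K. a k) ^ 4) =
    (\<Sum>k\<in>K. \<Sum>l\<in>K. \<Sum>m\<in>K. \<Sum>p\<in>K. a k * a l * cnj (a m) * cnj (a p))"
proof -
  have "complex_of_real (norm z ^ 4) = z * z * cnj z * cnj z" for z
  proof -
    have "complex_of_real (norm z ^ 4) = complex_of_real (norm z ^ 2) ^ 2"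
      by (simp flip: power_mult)
    then show ?thesis
      unfolding complex_norm_square by (simp add: power2_eq_square mult_ac)
  qed
  then show ?thesis
    by (simp add: cnj_sum mult.assoc flip: sum_distrib_left sum_distrib_right)
qed

lemma has_bochner_integral_F_sigma_power4:
  "has_bochner_integral unit_square (\<lambda>x. complex_of_real (norm (F_sigma \<sigma> N x) ^ 4))
     (\<Sum>k<N. \<Sum>l<N. \<Sum>m<N. \<Sum>p<N.
        of_bool (int k + int l - int m - int p = 0) * of_bool (\<sigma> k XOR \<sigma> l XOR \<sigma> m = \<sigma> p))"
proof -
  let ?u = "\<lambda>k l m p s. trig k s * trig l s * cnj (trig m s) * cnj (trig p s)"
  let ?v = "\<lambda>k l m p t.
    complex_of_real (walsh (\<sigma> k) t * walsh (\<sigma> l) t * walsh (\<sigma> m) t * walsh (\<sigma> p) t)"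
  have expand: "complex_of_real (norm (F_sigma \<sigma> N x) ^ 4) =
      (\<Sum>k<N. \<Sum>l<N. \<Sum>m<N. \<Sum>p<N. case x of (s, t) \<Rightarrow> ?u k l m p s * ?v k l m p t)" for x
    unfolding F_sigma_def split_beta norm_sum_power4 by (simp add: mult_ac)
  have "has_bochner_integral unit_square (\<lambda>(s, t). ?u k l m p s * ?v k l m p t)
      (of_bool (int k + int l - int m - int p = 0) * of_bool (\<sigma> k XOR \<sigma> l XOR \<sigma> m = \<sigma> p))"
    for k l m p
  proof -
    have u: "?u k l m p \<in> borel_measurable borel"
      unfolding trig_prod_eq_exp by (intro borel_measurable_continuous_onI continuous_intros)
    have v: "?v k l m p \<in> borel_measurable borel"
      by measurable
    have "set_integrable lborel {0..1} (?u k l m p)"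
      using u by (rule set_integrable_unit_interval_bounded[where B = 1])
        (simp add: norm_mult norm_trig)
    moreover have "norm (?v k l m p t) \<le> 1" for t
      unfolding norm_of_real abs_mult by (intro mult_le_one abs_walsh_le_1) simp_all
    then have "set_integrable lborel {0..1} (?v k l m p)"
      using v by (intro set_integrable_unit_interval_bounded[where B = 1])
    ultimately show ?thesis
      using has_bochner_integral_unit_square_mult[of "?u k l m p" "?v k l m p"]
      unfolding LINT_walsh_prod_eq_of_bool trig_prod_eq_exp LINT_exp_eq_of_bool by simp
  qed
  then show ?thesis
    unfolding expand by (intro has_bochner_integral_sum)
qed

text \<open>For given \<open>k\<close>, \<open>l\<close>, \<open>m\<close> the only candidate for \<open>p\<close> is \<open>k + l - m\<close>, and it counts exactly if
  this difference lies in the index range.\<close>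

lemma sum_solutions_eq_card_A_sigma:
  "(\<Sum>k<2 ^ n. \<Sum>l<2 ^ n. \<Sum>m<2 ^ n. \<Sum>p<2 ^ n.
      of_bool (int k + int l - int m - int p = 0) * of_bool (\<sigma> k XOR \<sigma> l XOR \<sigma> m = \<sigma> p)) =
    (of_nat (card (A_sigma \<sigma> n)) :: complex)"
proof -
  let ?N = "2 ^ n :: nat"
  let ?T = "{..<?N} \<times> {..<?N} \<times> {..<?N}"
  let ?P = "\<lambda>k l m. m \<le> k + l \<and> k + l - m < ?N \<and> \<sigma> k XOR \<sigma> l XOR \<sigma> m = \<sigma> (k + l - m)"
  have "(\<Sum>p<?N. of_bool (int k + int l - int m - int p = 0) *
          of_bool (\<sigma> k XOR \<sigma> l XOR \<sigma> m = \<sigma> p)) = (of_bool (?P k l m) :: complex)" for k l m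
  proof -
    have "(\<Sum>p<?N. of_bool (int k + int l - int m - int p = 0) *
          of_bool (\<sigma> k XOR \<sigma> l XOR \<sigma> m = \<sigma> p)) =
        (\<Sum>p<?N. if p = k + l - m then of_bool (?P k l m) else 0 :: complex)"
      by (intro sum.cong refl) auto
    also have "\<dots> = of_bool (?P k l m)"
      by (auto simp: sum.delta)
    finally show ?thesis .
  qed
  then have "(\<Sum>k<?N. \<Sum>l<?N. \<Sum>m<?N. \<Sum>p<?N.
      of_bool (int k + int l - int m - int p = 0) * of_bool (\<sigma> k XOR \<sigma> l XOR \<sigma> m = \<sigma> p)) =
      (\<Sum>(k, l, m)\<in>?T. of_bool (?P k l m) :: complex)"
    by (simp only: sum.cartesian_product[symmetric])
  also have "\<dots> = (\<Sum>x\<in>?T. of_bool (x \<in> A_sigma \<sigma> n))"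
    by (intro sum.cong refl) (auto simp: A_sigma_def)
  also have "\<dots> = of_nat (card (?T \<inter> A_sigma \<sigma> n))"
    by simp
  also have "?T \<inter> A_sigma \<sigma> n = A_sigma \<sigma> n"
    by (auto simp: A_sigma_def)
  finally show ?thesis .
qed

theorem lemma4p1:
  fixes \<sigma> :: "nat \<Rightarrow> nat" and n :: nat
  assumes "bij \<sigma>"
  shows "Lp_norm 4 unit_square (F_sigma \<sigma> (2 ^ n)) ^ 4 = real (card (A_sigma \<sigma> n))"
proof -
  let ?I = "LINT x|unit_square. norm (F_sigma \<sigma> (2 ^ n) x) powr 4"
  have "complex_of_real ?I = (LINT x|unit_square. complex_of_real (norm (F_sigma \<sigma> (2 ^ n) x) ^ 4))"
    by (simp flip: integral_complex_of_real)
  also have "\<dots> = of_nat (card (A_sigma \<sigma> n))"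
    using has_bochner_integral_F_sigma_power4[of \<sigma> "2 ^ n"]
    unfolding sum_solutions_eq_card_A_sigma by (rule has_bochner_integral_integral_eq)
  finally have "?I = real (card (A_sigma \<sigma> n))"
    by (metis of_real_eq_iff of_real_of_nat_eq)
  moreover have "(c powr (1 / 4)) ^ 4 = c" if "c \<ge> 0" for c :: real
    using that by (cases "c = 0") (simp_all add: powr_power)
  ultimately show ?thesis
    by (simp add: Lp_norm_def)
qed

end
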